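(* Let $Q_{n,j}$ ($n,j\ge0$) be the formal power series in $\mathbf x=(x_1,x_2,\dots)$ given by $Q_{n,j}=\sum_{\sigma\in\mathfrak S_n,\ \mathrm{exc}(\sigma)=j}F_{\mathrm{EXD}(\sigma),n}(\mathbf x)$, and let $H(z)=\sum_{n\ge0}h_n(\mathbf x)z^n$. Then $$\sum_{n,j\ge0}Q_{n,j}\,t^jz^n=\frac{(1-t)H(z)}{H(zt)-tH(z)}.$$
   Context: $\mathbf x=(x_1,x_2,\dots)$ is an infinite sequence of commuting indeterminates; $h_n(\mathbf x)=\sum_{1\le i_1\le\dots\le i_n}x_{i_1}\cdots x_{i_n}$ is the complete homogeneous symmetric function, $h_0=1$. $\mathfrak S_n$ is the set of permutations of $[n]=\{1,\dots,n\}$, and $\mathrm{exc}(\sigma)=|\{i\in[n-1]:\sigma(i)>i\}|$. Excedance-descent set: for $\sigma\in\mathfrak S_n$ let $\bar\sigma$ be the word obtained from $\sigma(1)\sigma(2)\cdots\sigma(n)$ by placing a bar over each letter $\sigma(i)$ with $\sigma(i)>i$ (e.g. $531462\mapsto\bar5\bar314\bar62$), viewed as a word over the ordered alphabet $\bar1<\bar2<\dots<\bar n<1<2<\dots<n$. Then $\mathrm{EXD}(\sigma)=\{i\in[n-1]:\bar\sigma_i>\bar\sigma_{i+1}\}$, where $\bar\sigma_i$ is the $i$th letter of $\bar\sigma$. For $n\ge1$ and $S\subseteq[n-1]$, $F_{S,n}(\mathbf x)=\sum x_{i_1}\cdots x_{i_n}$, summed over all sequences of positive integers $i_1\ge i_2\ge\dots\ge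 i_n$ such that $i_j>i_{j+1}$ whenever $j\in S$; and $F_{\emptyset,0}=1$ (so $Q_{0,0}=1$ and $Q_{0,j}=0$ for $j>0$). The identity is one of formal power series in $z$, where the denominator on the right has constant term $1-t$ (invertible in $\mathbb Q(t)$ or $\mathbb Z[[t]]$). *)

theory Defs
  imports
    "HOL-Library.Multiset"
    "HOL-Combinatorics.Permutations"
    "HOL-Computational_Algebra.Formal_Power_Series"
begin

text \<open>
  Formal power series in commuting indeterminates indexed by \<open>'v\<close> (possibly infinitely many),
  with coefficients in \<open>'a\<close>.  The monomial \<open>x\<^sub>v\<^sub>1 \<cdots> x\<^sub>v\<^sub>n\<close> is the multiset \<open>mset [v1, \<dots>, vn]\<close>, and a
  power series is an arbitrary function from monomials to coefficients.
\<close>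

typedef ('v, 'a) mvps = "UNIV :: ('v multiset \<Rightarrow> 'a) set"
  morphisms mcoeff Abs_mvps
  by simp

lemma mcoeff_Abs [simp]: "mcoeff (Abs_mvps f) = f"
  by (simp add: Abs_mvps_inverse)

lemma mvps_eqI: "(\<And>m. mcoeff f m = mcoeff g m) \<Longrightarrow> f = g"
  by (metis ext mcoeff_inject)

definition msplits :: "'v multiset \<Rightarrow> ('v multiset \<times> 'v multiset) set" where
  "msplits m = {(a, b). a + b = m}"

lemma finite_submultisets: "finite {a. a \<subseteq># (m :: 'v multiset)}"
proof -
  have "{a. a \<subseteq># m} \<subseteq> mset ` {xs. set xs \<subseteq> set_mset m \<and> length xs \<le> size m}"
  proof
    fix a assume "a \<in> {a. a \<subseteq># m}"
    hence a: "a \<subseteq># m" by simp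
    obtain xs where xs: "mset xs = a" using ex_mset by blast
    have "set xs \<subseteq> set_mset m" using set_mset_mono[OF a] xs by auto
    moreover have "length xs \<le> size m" using size_mset_mono[OF a] xs by auto
    ultimately show "a \<in> mset ` {xs. set xs \<subseteq> set_mset m \<and> length xs \<le> size m}"
      using xs by blast
  qed
  thus ?thesis by (rule finite_subset) (simp add: finite_lists_length_le)
qed

lemma finite_msplits [simp]: "finite (msplits m)"
proof -
  have "msplits m \<subseteq> {a. a \<subseteq># m} \<times> {a. a \<subseteq># m}"
    by (auto simp: msplits_def)
  thus ?thesis by (rule finite_subset) (simp add: finite_submultisets)
qed

instantiation mvps :: (type, comm_ring_1) comm_ring_1
begin

definition "0 = Abs_mvps (\<lambda>_. 0)"
definition "1 = Abs_mvps (\<lambda>m. if m = {#} then 1 else 0)"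
definition "f + g = Abs_mvps (\<lambda>m. mcoeff f m + mcoeff g m)"
definition "f - g = Abs_mvps (\<lambda>m. mcoeff f m - mcoeff g m)"
definition "- f = Abs_mvps (\<lambda>m. - mcoeff f m)"
definition "f * g = Abs_mvps (\<lambda>m. \<Sum>(a, b)\<in>msplits m. mcoeff f a * mcoeff g b)"

lemmas mvps_defs = zero_mvps_def one_mvps_def plus_mvps_def minus_mvps_def uminus_mvps_def
  times_mvps_def

instance
proof
  fix f g h :: "('a, 'b) mvps"
  show "f + g + h = f + (g + h)" "f + g = g + f" "0 + f = f" "- f + f = 0" "f - g = f + - g"
    by (auto intro!: mvps_eqI simp: mvps_defs)
  show "(0 :: ('a, 'b) mvps) \<noteq> 1"
  proof
    assume "(0 :: ('a, 'b) mvps) = 1"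
    hence "mcoeff (0 :: ('a, 'b) mvps) {#} = mcoeff 1 {#}" by simp
    thus False by (simp add: mvps_defs)
  qed
  show "f * g = g * f"
  proof (rule mvps_eqI)
    fix m
    show "mcoeff (f * g) m = mcoeff (g * f) m"
      unfolding times_mvps_def mcoeff_Abs
      by (rule sum.reindex_bij_witness[of _ prod.swap prod.swap])
         (auto simp: msplits_def ac_simps)
  qed
  show "(f + g) * h = f * h + g * h"
    by (rule mvps_eqI)
       (simp add: times_mvps_def plus_mvps_def case_prod_unfold distrib_right sum.distrib)
  show "1 * f = f"
  proof (rule mvps_eqI)
    fix m
    have "mcoeff (1 * f) m = (\<Sum>p\<in>msplits m. if p = ({#}, m) then mcoeff f m else 0)"
      unfolding times_mvps_def mcoeff_Abs one_mvps_def
      by (rule sum.cong) (auto simp: msplits_def split: if_splits)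
    also have "\<dots> = mcoeff f m"
      by (subst sum.delta, rule finite_msplits) (auto simp: msplits_def)
    finally show "mcoeff (1 * f) m = mcoeff f m" .
  qed
  show "f * g * h = f * (g * h)"
  proof (rule mvps_eqI)
    fix m
    have "mcoeff (f * g * h) m =
        (\<Sum>p\<in>msplits m. \<Sum>q\<in>msplits (fst p). mcoeff f (fst q) * mcoeff g (snd q) * mcoeff h (snd p))"
      by (simp add: times_mvps_def case_prod_unfold sum_distrib_right)
    also have "\<dots> = (\<Sum>(p, q)\<in>Sigma (msplits m) (\<lambda>p. msplits (fst p)).
        mcoeff f (fst q) * mcoeff g (snd q) * mcoeff h (snd p))"
      by (rule sum.Sigma) auto
    also have "\<dots> = (\<Sum>(p, q)\<in>Sigma (msplits m) (\<lambda>p. msplits (snd p)).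
        mcoeff f (fst p) * (mcoeff g (fst q) * mcoeff h (snd q)))"
      by (rule sum.reindex_bij_witness
            [of _ "\<lambda>(p, q). ((fst p + fst q, snd q), (fst p, fst q))"
                  "\<lambda>(p, q). ((fst q, snd q + snd p), (snd q, snd p))"])
         (auto simp: msplits_def ac_simps)
    also have "\<dots> = (\<Sum>p\<in>msplits m. \<Sum>q\<in>msplits (snd p).
        mcoeff f (fst p) * (mcoeff g (fst q) * mcoeff h (snd q)))"
      by (rule sum.Sigma[symmetric]) auto
    also have "\<dots> = mcoeff (f * (g * h)) m"
      by (simp add: times_mvps_def case_prod_unfold sum_distrib_left)
    finally show "mcoeff (f * g * h) m = mcoeff (f * (g * h)) m" .
  qed
qed

end

text \<open>
  The formal sum of \<open>x\<^sub>w\<^sub>1 \<cdots> x\<^sub>w\<^sub>n\<close> over all words \<open>w\<close> in \<open>A\<close>.  Only finitely many words share a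
  given monomial, so the cardinality is that of a finite set even when \<open>A\<close> is infinite.
\<close>

definition word_series :: "'v list set \<Rightarrow> ('v, 'a :: comm_ring_1) mvps" where
  "word_series A = Abs_mvps (\<lambda>m. of_nat (card {w \<in> A. mset w = m}))"

lemma finite_words_of_monomial: "finite {w \<in> A. mset w = m}"
  by (rule finite_subset[OF _ mset_eq_finite[of "SOME w. mset w = m"]])
     (use someI_ex[OF ex_mset[of m]] in auto)

text \<open>
  Variables are indexed by the positive integers; the indeterminate with index 0 is available in
  the type but occurs in none of the series below.  Words \<open>i\<^sub>1 \<dots> i\<^sub>n\<close> are 0-based lists, so \<open>i\<^sub>j\<close> is
  \<open>w ! (j - 1)\<close>.
\<close>

type_synonym xps = "(nat, int) mvps"

definition hsym :: "nat \<Rightarrow> xps" where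
  "hsym n = word_series {w. length w = n \<and> (\<forall>i\<in>set w. 1 \<le> i) \<and> sorted w}"

definition Fquasi :: "nat set \<Rightarrow> nat \<Rightarrow> xps" where
  "Fquasi S n = word_series {w. length w = n \<and> (\<forall>i\<in>set w. 1 \<le> i) \<and>
     (\<forall>j\<in>{1..<n}. w ! (j - 1) \<ge> w ! j) \<and>
     (\<forall>j\<in>S. w ! (j - 1) > w ! j)}"

definition exc :: "nat \<Rightarrow> (nat \<Rightarrow> nat) \<Rightarrow> nat" where
  "exc n \<sigma> = card {i \<in> {1..<n}. \<sigma> i > i}"

datatype letter = Barred nat | Plain nat

fun letter_less :: "letter \<Rightarrow> letter \<Rightarrow> bool" where
  "letter_less (Barred a) (Barred b) \<longleftrightarrow> a < b"
| "letter_less (Barred a) (Plain b) \<longleftrightarrow> True"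
| "letter_less (Plain a) (Barred b) \<longleftrightarrow> False"
| "letter_less (Plain a) (Plain b) \<longleftrightarrow> a < b"

definition bar_word :: "(nat \<Rightarrow> nat) \<Rightarrow> nat \<Rightarrow> letter" where
  "bar_word \<sigma> i = (if \<sigma> i > i then Barred (\<sigma> i) else Plain (\<sigma> i))"

definition EXD :: "nat \<Rightarrow> (nat \<Rightarrow> nat) \<Rightarrow> nat set" where
  "EXD n \<sigma> = {i \<in> {1..<n}. letter_less (bar_word \<sigma> (i + 1)) (bar_word \<sigma> i)}"

definition Qeuler :: "nat \<Rightarrow> nat \<Rightarrow> xps" where
  "Qeuler n j = (\<Sum>\<sigma> | \<sigma> permutes {1..n} \<and> exc n \<sigma> = j. Fquasi (EXD n \<sigma>) n)"

text \<open>
  The ring of the identity is \<open>\<int>[[x]][[t]][[z]]\<close>, i.e. \<open>xps fps fps\<close>: the inner series variable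
  is \<open>t\<close>, the outer one is \<open>z\<close>.
\<close>

definition tvar :: "xps fps fps" where
  "tvar = fps_const fps_X"

definition zvar :: "xps fps fps" where
  "zvar = fps_X"

definition Hgen :: "xps fps fps" where
  "Hgen = Abs_fps (\<lambda>n. fps_const (hsym n))"

definition Qgen :: "xps fps fps" where
  "Qgen = Abs_fps (\<lambda>n. Abs_fps (\<lambda>j. Qeuler n j))"

text \<open>
  The quotient by a unit of a commutative ring (the library's division on power series needs a
  coefficient type with an \<open>inverse\<close> operation).  It is meaningful only if \<open>d dvd 1\<close>.
\<close>

definition unit_quot :: "'a :: comm_ring_1 \<Rightarrow> 'a \<Rightarrow> 'a" where
  "unit_quot a d = a * (THE u. d * u = 1)"

lemma unit_quot_eq_iff:
  assumes "d dvd 1"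
  shows "q = unit_quot a d \<longleftrightarrow> q * d = a"
proof -
  obtain u where u: "d * u = 1" using assms by (metis dvdE)
  have "(THE u. d * u = 1) = u"
  proof (rule the_equality)
    show "d * u = 1" by (fact u)
    fix v assume v: "d * v = 1"
    have "v = v * (d * u)" using u by simp
    also have "\<dots> = (d * v) * u" by (simp only: ac_simps)
    finally show "v = u" using v by simp
  qed
  hence *: "unit_quot a d = a * u" by (simp add: unit_quot_def)
  have "a * u * d = a * (d * u)" "q * d * u = q * (d * u)" by (simp_all only: ac_simps)
  thus ?thesis using u * by auto
qed

end

theory Submission
  imports Defs "HOL-Library.Product_Lexorder"
begin

text \<open>
  Fix a monomial \<open>m\<close>, i.e. a weakly decreasing word \<open>w\<close>, which cuts the positions \<open>1, \<dots>, n\<close> into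
  blocks, one for each letter \<open>v\<close>, of size \<open>m v\<close>.  A permutation \<open>\<sigma>\<close> contributes to the coefficient of
  \<open>m\<close> iff its barred word increases along each block, and then \<open>\<sigma>\<close> is determined by recording for
  every value its block and whether it is barred.  The admissible records are those in which
  every value is chosen independently from an explicit set, so the coefficient is
  \<open>[y\<^sup>m] \<Prod>\<^sub>v (L\<^sub>v - t y\<^sub>v) L\<^sub>v\<^bsup>m v - 1\<^esup>\<close> with
  \<open>L\<^sub>v = t \<Sum>\<^sub>k\<^sub>>\<^sub>v y\<^sub>k + (1 + t) y\<^sub>v + \<Sum>\<^sub>k\<^sub><\<^sub>v y\<^sub>k\<close>.

  Let \<open>M\<close> be the series with coefficients \<open>[y\<^sup>m] \<Prod>\<^sub>v L\<^sub>v\<^bsup>m v\<^esup>\<close> and \<open>E(u) = \<Prod>\<^sub>v (1 - u x\<^sub>v) = 1/H(u)\<close>.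
  Then \<open>M E(u)\<close> has coefficients \<open>[y\<^sup>m] \<Prod>\<^sub>v (L\<^sub>v - u y\<^sub>v) L\<^sub>v\<^bsup>m v - 1\<^esup>\<close>, so \<open>Q = M E(t)\<close>.  For \<open>m \<noteq> 1\<close> the
  product telescopes to \<open>\<Prod>\<^sub>v (L\<^sub>v - y\<^sub>v) = t \<Prod>\<^sub>v (L\<^sub>v - t y\<^sub>v)\<close>, whence \<open>M (E(1) - t E(t)) = 1 - t\<close>.
  Multiplying by \<open>H(1)\<close> and \<open>E(t) H(t) = 1\<close> gives \<open>Q (H(t) - t H(1)) = (1 - t) H(1)\<close>.  The variable
  \<open>z\<close> only records the degree and is put back at the end.
\<close>

section \<open>Monomials and restriction of variables\<close>

lemma mcoeff_zero [simp]: "mcoeff 0 m = 0"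
  and mcoeff_one: "mcoeff 1 m = (if m = {#} then 1 else 0)"
  and mcoeff_add [simp]: "mcoeff (f + g) m = mcoeff f m + mcoeff g m"
  and mcoeff_diff [simp]: "mcoeff (f - g) m = mcoeff f m - mcoeff g m"
  and mcoeff_mult: "mcoeff (f * g) m = (\<Sum>(a, b)\<in>msplits m. mcoeff f a * mcoeff g b)"
  by (simp_all add: mvps_defs)

lemma mcoeff_sum [simp]: "mcoeff (sum f A) m = (\<Sum>x\<in>A. mcoeff (f x) m)"
  by (induction A rule: infinite_finite_induct) auto

definition mmonom :: "'a::comm_ring_1 \<Rightarrow> 'v multiset \<Rightarrow> ('v, 'a) mvps" where
  "mmonom c a = Abs_mvps (\<lambda>m. if m = a then c else 0)"

lemma mcoeff_mmonom: "mcoeff (mmonom c a) m = (if m = a then c else 0)"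
  by (simp add: mmonom_def)

lemma one_eq_mmonom: "1 = mmonom 1 {#}"
  by (rule mvps_eqI) (simp add: mcoeff_mmonom mcoeff_one)

lemma mcoeff_mmonom_mult:
  "mcoeff (mmonom c a * f) m = (if a \<subseteq># m then c * mcoeff f (m - a) else 0)"
proof -
  have "mcoeff (mmonom c a * f) m =
      (\<Sum>p\<in>msplits m. if p = (a, m - a) then c * mcoeff f (m - a) else 0)"
    unfolding mcoeff_mult by (rule sum.cong) (auto simp: msplits_def mcoeff_mmonom split: if_splits)
  also have "\<dots> = (if (a, m - a) \<in> msplits m then c * mcoeff f (m - a) else 0)"
    by (rule sum.delta) simp
  also have "(a, m - a) \<in> msplits m \<longleftrightarrow> a \<subseteq># m"
    unfolding msplits_def by (auto intro: subset_mset.add_diff_inverse) (metis mset_subset_eq_add_left)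
  finally show ?thesis by simp
qed

lemma mmonom_uminus: "mmonom (- c) a = - mmonom c a"
  by (rule mvps_eqI) (simp add: mcoeff_mmonom uminus_mvps_def)

lemma mmonom_mult: "mmonom c a * mmonom d b = mmonom (c * d) (a + b)"
  by (rule mvps_eqI) (auto simp: mcoeff_mmonom_mult mcoeff_mmonom)

lemma prod_mmonom: "(\<Prod>x\<in>A. mmonom (c x) (a x)) = mmonom (\<Prod>x\<in>A. c x) (\<Sum>x\<in>A. a x)"
  by (induction A rule: infinite_finite_induct) (auto simp: one_eq_mmonom mmonom_mult)

text \<open>Substitution of 0 for the indeterminates outside \<open>V\<close>; it is multiplicative,
  so it can be applied factor by factor.\<close>

definition restrict_vars :: "'v set \<Rightarrow> ('v, 'a::comm_ring_1) mvps \<Rightarrow> ('v, 'a) mvps" where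
  "restrict_vars V f = Abs_mvps (\<lambda>m. if set_mset m \<subseteq> V then mcoeff f m else 0)"

lemma mcoeff_restrict_vars:
  "mcoeff (restrict_vars V f) m = (if set_mset m \<subseteq> V then mcoeff f m else 0)"
  by (simp add: restrict_vars_def)

lemma restrict_vars_one: "restrict_vars V 1 = 1"
  by (rule mvps_eqI) (simp add: mcoeff_restrict_vars mcoeff_one)

lemma restrict_vars_mult: "restrict_vars V (f * g) = restrict_vars V f * restrict_vars V g"
proof (rule mvps_eqI)
  fix m
  have "(\<Sum>p\<in>msplits m. mcoeff (restrict_vars V f) (fst p) * mcoeff (restrict_vars V g) (snd p)) =
     (\<Sum>p\<in>msplits m. if set_mset m \<subseteq> V then mcoeff f (fst p) * mcoeff g (snd p) else 0)"
    by (rule sum.cong) (auto simp: mcoeff_restrict_vars msplits_def)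
  thus "mcoeff (restrict_vars V (f * g)) m = mcoeff (restrict_vars V f * restrict_vars V g) m"
    by (simp add: mcoeff_mult mcoeff_restrict_vars case_prod_unfold)
qed

lemma restrict_vars_power: "restrict_vars V (f ^ n) = restrict_vars V f ^ n"
  by (induction n) (simp_all add: restrict_vars_one restrict_vars_mult)

lemma restrict_vars_prod: "restrict_vars V (prod f A) = (\<Prod>x\<in>A. restrict_vars V (f x))"
  by (induction A rule: infinite_finite_induct) (simp_all add: restrict_vars_one restrict_vars_mult)

section \<open>Complete and elementary symmetric series\<close>

definition hser :: "'a::comm_ring_1 \<Rightarrow> ('v, 'a) mvps" where
  "hser u = Abs_mvps (\<lambda>m. u ^ size m)"

text \<open>The infinite product of the factors \<open>1 - u x\<^sub>v\<close>, written
  coefficientwise: the condition selects squarefree monomials.\<close>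

definition eser :: "'a::comm_ring_1 \<Rightarrow> ('v, 'a) mvps" where
  "eser u = Abs_mvps (\<lambda>m. if m = mset_set (set_mset m) then (- u) ^ size m else 0)"

lemma mset_set_msubset: "S \<subseteq> set_mset m \<Longrightarrow> mset_set S \<subseteq># m"
  by (meson finite_set_mset mset_set_set_mset_msubset subset_imp_msubset_mset_set
      subset_mset.order_trans)

lemma mcoeff_mult_eser:
  "mcoeff (f * eser u) m =
     (\<Sum>S\<in>Pow (set_mset m). mcoeff f (m - mset_set S) * (- u) ^ card S)"
proof -
  let ?P = "{p \<in> msplits m. snd p = mset_set (set_mset (snd p))}"
  have "mcoeff (f * eser u) m =
      (\<Sum>p\<in>msplits m. if snd p = mset_set (set_mset (snd p))
         then mcoeff f (fst p) * (- u) ^ size (snd p) else 0)"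
    unfolding mcoeff_mult case_prod_unfold by (rule sum.cong) (auto simp: eser_def)
  also have "\<dots> = (\<Sum>p\<in>?P. mcoeff f (fst p) * (- u) ^ size (snd p))"
    by (rule sum.inter_filter[symmetric]) simp
  also have "\<dots> = (\<Sum>S\<in>Pow (set_mset m). mcoeff f (m - mset_set S) * (- u) ^ card S)"
  proof (rule sum.reindex_bij_witness[of _ "\<lambda>S. (m - mset_set S, mset_set S)" "\<lambda>p. set_mset (snd p)"])
    fix p assume p: "p \<in> ?P"
    hence m: "m = fst p + snd p" and s: "mset_set (set_mset (snd p)) = snd p"
      by (auto simp: msplits_def)
    show "(m - mset_set (set_mset (snd p)), mset_set (set_mset (snd p))) = p"
      unfolding s m by simp
    show "set_mset (snd p) \<in> Pow (set_mset m)" unfolding m by auto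
    show "mcoeff f (m - mset_set (set_mset (snd p))) * (- u) ^ card (set_mset (snd p)) =
         mcoeff f (fst p) * (- u) ^ size (snd p)"
      unfolding s m by (simp flip: size_mset_set add: s)
  next
    fix S assume "S \<in> Pow (set_mset m)"
    hence S: "S \<subseteq> set_mset m" "finite S" by (auto intro: finite_subset)
    show "set_mset (snd (m - mset_set S, mset_set S)) = S" using S by simp
    show "(m - mset_set S, mset_set S) \<in> ?P" using S mset_set_msubset[OF S(1)] by (simp add: msplits_def)
  qed
  finally show ?thesis .
qed

lemma hser_mult_eser: "hser u * eser u = (1 :: ('v, 'a::comm_ring_1) mvps)"
proof (rule mvps_eqI)
  fix m :: "'v multiset"
  have "mcoeff (hser u * eser u) m =
      (\<Sum>S\<in>Pow (set_mset m). u ^ size m * ((\<Prod>x\<in>S. - 1) * (\<Prod>x\<in>set_mset m - S. 1)))"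
    unfolding mcoeff_mult_eser
  proof (rule sum.cong[OF refl])
    fix S assume "S \<in> Pow (set_mset m)"
    hence S: "S \<subseteq> set_mset m" by simp
    hence "size m = size (m - mset_set S) + card S"
      by (metis mset_set_msubset size_mset_set size_union subset_mset.diff_add)
    thus "mcoeff (hser u) (m - mset_set S) * (- u) ^ card S =
        u ^ size m * ((\<Prod>x\<in>S. - 1) * (\<Prod>x\<in>set_mset m - S. 1))"
      by (simp add: hser_def power_add power_minus[of u])
  qed
  \<comment> \<open>The signed sum over subsets is an expanded product of factors
    \<open>- 1 + 1\<close>, which vanishes unless the support is empty.\<close>
  also have "\<dots> = u ^ size m * (\<Prod>x\<in>set_mset m. - 1 + 1)"
    by (subst prod_add) (simp_all add: sum_distrib_left)
  also have "\<dots> = mcoeff 1 m"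
    by (auto simp: mcoeff_one power_0_left)
  finally show "mcoeff (hser u * eser u) m = mcoeff 1 m" .
qed

section \<open>A product of linear forms\<close>

text \<open>
  The coefficient of \<open>y\<^sub>k\<close> in \<open>lform t T v\<close> counts the ways in which a value lying in the block of
  \<open>v\<close>, but not its first element, can occur in the block of \<open>k\<close>: as a barred letter (weight \<open>t\<close>) or as a plain one (weight 1).
  Blocks of larger letters come first, since words are weakly decreasing.
\<close>

definition lform :: "'a::comm_ring_1 \<Rightarrow> 'v::linorder set \<Rightarrow> 'v \<Rightarrow> ('v, 'a) mvps" where
  "lform t T v = (\<Sum>k\<in>T. mmonom (if v < k then t else if k = v then 1 + t else 1) {#k#})"

lemma restrict_vars_lform:
  assumes "finite T" "V \<subseteq> T"
  shows "restrict_vars V (lform t T v) = lform t V v"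
proof (rule mvps_eqI)
  fix m
  let ?c = "\<lambda>k. mcoeff (mmonom (if v < k then t else if k = v then 1 + t else 1) {#k#}) m"
  have "(if set_mset m \<subseteq> V then (\<Sum>k\<in>T. ?c k) else 0) =
      (\<Sum>k\<in>T. if set_mset m \<subseteq> V then ?c k else 0)" by (cases "set_mset m \<subseteq> V") simp_all
  also have "\<dots> = (\<Sum>k\<in>T. if k \<in> V then ?c k else 0)"
    by (rule sum.cong) (auto simp: mcoeff_mmonom)
  also have "\<dots> = (\<Sum>k\<in>{k\<in>T. k \<in> V}. ?c k)"
    by (rule sum.inter_filter[symmetric]) (use assms in auto)
  also have "{k\<in>T. k \<in> V} = V" using assms by auto
  finally show "mcoeff (restrict_vars V (lform t T v)) m = mcoeff (lform t V v) m"
    by (simp only: mcoeff_restrict_vars lform_def mcoeff_sum)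
qed

text \<open>As in MacMahon's master theorem, each coefficient is taken from its own product. Cutting
  the alphabet down to the support keeps the forms finite sums.\<close>

definition master_ser :: "'a::comm_ring_1 \<Rightarrow> ('v::linorder, 'a) mvps" where
  "master_ser t = Abs_mvps (\<lambda>m. mcoeff (\<Prod>v\<in>set_mset m. lform t (set_mset m) v ^ count m v) m)"

text \<open>Letters outside \<open>m\<close> have exponent 0, and setting their indeterminates to 0
  preserves the coefficient of \<open>m\<close>. A common \<open>T\<close> serves to compare
  monomials with different supports.\<close>

lemma mcoeff_master_ser:
  assumes "finite T" "set_mset m \<subseteq> T"
  shows "mcoeff (master_ser t) m = mcoeff (\<Prod>v\<in>T. lform t T v ^ count m v) m"
proof -
  have "(\<Prod>v\<in>T. lform t T v ^ count m v) = (\<Prod>v\<in>set_mset m. lform t T v ^ count m v)"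
    using assms by (intro prod.mono_neutral_right) (auto simp: not_in_iff)
  hence "mcoeff (\<Prod>v\<in>T. lform t T v ^ count m v) m =
      mcoeff (restrict_vars (set_mset m) (\<Prod>v\<in>set_mset m. lform t T v ^ count m v)) m"
    by (simp add: mcoeff_restrict_vars)
  also have "restrict_vars (set_mset m) (\<Prod>v\<in>set_mset m. lform t T v ^ count m v) =
      (\<Prod>v\<in>set_mset m. lform t (set_mset m) v ^ count m v)"
    using assms by (simp add: restrict_vars_prod restrict_vars_power restrict_vars_lform)
  finally show ?thesis by (simp add: master_ser_def)
qed

text \<open>Expand the product on the right: taking \<open>- u y\<^sub>v\<close> for
  \<open>v \<in> S\<close> and the linear form elsewhere gives the summand of \<open>S\<close> in
  \<open>mcoeff_mult_eser\<close>.\<close>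

lemma mcoeff_master_ser_mult_eser:
  fixes t u :: "'a::comm_ring_1" and m :: "'v::linorder multiset"
  defines "T \<equiv> set_mset m"
  shows "mcoeff (master_ser t * eser u) m =
    mcoeff (\<Prod>v\<in>T. (lform t T v - mmonom u {#v#}) * lform t T v ^ (count m v - 1)) m"
proof -
  have fin: "finite T" by (simp add: T_def)
  let ?L = "lform t T" and ?R = "\<Prod>v\<in>T. lform t T v ^ (count m v - 1)"
  have "(\<Prod>v\<in>T. (?L v - mmonom u {#v#}) * ?L v ^ (count m v - 1)) =
      (\<Prod>v\<in>T. mmonom (- u) {#v#} + ?L v) * ?R"
    by (simp add: prod.distrib mmonom_uminus)
  also have "\<dots> = (\<Sum>S\<in>Pow T. (\<Prod>v\<in>S. mmonom (- u) {#v#}) * ((\<Prod>v\<in>T - S. ?L v) * ?R))"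
    by (subst prod_add[OF fin]) (simp add: sum_distrib_right mult.assoc)
  also have "\<dots> = (\<Sum>S\<in>Pow T. mmonom ((- u) ^ card S) (mset_set S) *
      (\<Prod>v\<in>T. ?L v ^ count (m - mset_set S) v))"
  proof (rule sum.cong[OF refl])
    fix S assume "S \<in> Pow T"
    hence S: "S \<subseteq> T" "finite S" using fin by (auto intro: finite_subset)
    have "(\<Prod>v\<in>T - S. ?L v) = (\<Prod>v\<in>T. if v \<in> S then 1 else ?L v)"
      using S fin by (simp add: prod.If_cases Diff_eq)
    hence "(\<Prod>v\<in>T - S. ?L v) * ?R =
        (\<Prod>v\<in>T. (if v \<in> S then 1 else ?L v) * ?L v ^ (count m v - 1))"
      by (simp add: prod.distrib)
    also have "\<dots> = (\<Prod>v\<in>T. ?L v ^ count (m - mset_set S) v)"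
    proof (rule prod.cong[OF refl])
      fix v assume "v \<in> T"
      then obtain n where "count m v = Suc n" by (metis T_def count_greater_zero_iff gr0_implies_Suc)
      thus "(if v \<in> S then 1 else ?L v) * ?L v ^ (count m v - 1) = ?L v ^ count (m - mset_set S) v"
        using S by (simp add: count_mset_set')
    qed
    finally show "(\<Prod>v\<in>S. mmonom (- u) {#v#}) * ((\<Prod>v\<in>T - S. ?L v) * ?R) =
        mmonom ((- u) ^ card S) (mset_set S) * (\<Prod>v\<in>T. ?L v ^ count (m - mset_set S) v)"
      by (simp add: prod_mmonom)
  qed
  finally have *: "(\<Prod>v\<in>T. (?L v - mmonom u {#v#}) * ?L v ^ (count m v - 1)) = \<dots>" .
  show ?thesis
    unfolding * mcoeff_mult_eser mcoeff_sum T_def[symmetric]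
  proof (rule sum.cong[OF refl])
    fix S assume "S \<in> Pow T"
    hence S: "S \<subseteq> T" by simp
    hence sub: "mset_set S \<subseteq># m" unfolding T_def by (rule mset_set_msubset)
    have "set_mset (m - mset_set S) \<subseteq> T" unfolding T_def by (meson in_diffD subsetI)
    thus "mcoeff (master_ser t) (m - mset_set S) * (- u) ^ card S =
       mcoeff (mmonom ((- u) ^ card S) (mset_set S) *
         (\<Prod>v\<in>T. ?L v ^ count (m - mset_set S) v)) m"
      using sub by (simp add: mcoeff_mmonom_mult mcoeff_master_ser[OF fin] mult.commute)
  qed
qed

text \<open>
  If \<open>v\<^sub>1 < \<dots> < v\<^sub>r\<close> are the elements of \<open>T\<close>, the strict upper set of \<open>v\<^sub>i\<close> is the weak upper
  set of \<open>v\<^sub>i\<^sub>+\<^sub>1\<close>, so the two products share all factors but one.  The common part \<open>P\<close> is exposed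
  because the ring has zero divisors in general.
\<close>

lemma prod_upper_sets_telescope:
  fixes \<phi> :: "'v::linorder set \<Rightarrow> 'r::comm_ring_1"
  assumes "finite T" "T \<noteq> {}"
  shows "\<exists>P. (\<Prod>v\<in>T. \<phi> {k\<in>T. v \<le> k}) = \<phi> T * P \<and> (\<Prod>v\<in>T. \<phi> {k\<in>T. v < k}) = \<phi> {} * P"
  using assms
proof (induction T rule: finite_linorder_min_induct)
  case empty
  thus ?case by simp
next
  case (insert b A)
  have b: "b \<notin> A" using insert by auto
  have "{k \<in> insert b A. v \<le> k} = {k \<in> A. v \<le> k}" "{k \<in> insert b A. v < k} = {k \<in> A. v < k}"
    if "v \<in> A" for v using insert that by auto
  moreover have "{k \<in> insert b A. b \<le> k} = insert b A" "{k \<in> insert b A. b < k} = A"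
    using insert by auto
  ultimately have 1: "(\<Prod>v\<in>insert b A. \<phi> {k\<in>insert b A. v \<le> k}) = \<phi> (insert b A) * (\<Prod>v\<in>A. \<phi> {k\<in>A. v \<le> k})"
    and 2: "(\<Prod>v\<in>insert b A. \<phi> {k\<in>insert b A. v < k}) = \<phi> A * (\<Prod>v\<in>A. \<phi> {k\<in>A. v < k})"
    using insert.hyps(1) b by simp_all
  show ?case
  proof (cases "A = {}")
    case True
    thus ?thesis unfolding 1 2 by (intro exI[of _ 1]) simp
  next
    case False
    then obtain P where "(\<Prod>v\<in>A. \<phi> {k\<in>A. v \<le> k}) = \<phi> A * P" "(\<Prod>v\<in>A. \<phi> {k\<in>A. v < k}) = \<phi> {} * P"
      using insert.IH by blast
    thus ?thesis unfolding 1 2 by (intro exI[of _ "\<phi> A * P"]) (simp add: mult.left_commute)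
  qed
qed

text \<open>Subtracting \<open>y\<^sub>v\<close> turns the diagonal coefficient \<open>1 + t\<close>
  into \<open>t\<close>, subtracting \<open>t y\<^sub>v\<close> turns it into 1. So the factors are
  \<open>\<phi>\<close> of weak and strict upper sets; after telescoping, only
  \<open>\<phi> T\<close> and \<open>\<phi> {}\<close> differ, by a factor \<open>t\<close>.\<close>

lemma prod_lform_diff:
  fixes t :: "'a::comm_ring_1" and T :: "'v::linorder set"
  assumes "finite T" "T \<noteq> {}"
  shows "(\<Prod>v\<in>T. lform t T v - mmonom 1 {#v#}) =
    mmonom t {#} * (\<Prod>v\<in>T. lform t T v - mmonom t {#v#})"
proof -
  define \<phi> :: "'v set \<Rightarrow> ('v, 'a) mvps" where
    "\<phi> U = (\<Sum>k\<in>T. mmonom (if k \<in> U then t else 1) {#k#})" for U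
  have *: "lform t T v - mmonom c {#v#} =
      (\<Sum>k\<in>T. mmonom (if v < k then t else if k = v then 1 + t - c else 1) {#k#})"
    if v: "v \<in> T" for v c
  proof -
    have "mmonom c {#v#} = (\<Sum>k\<in>T. if k = v then mmonom c {#k#} else 0)"
      using assms v by simp
    hence "lform t T v - mmonom c {#v#} = (\<Sum>k\<in>T.
       mmonom (if v < k then t else if k = v then 1 + t else 1) {#k#} -
       (if k = v then mmonom c {#k#} else 0))"
      by (simp add: lform_def sum_subtractf)
    also have "\<dots> = (\<Sum>k\<in>T. mmonom (if v < k then t else if k = v then 1 + t - c else 1) {#k#})"
      by (rule sum.cong) (auto intro!: mvps_eqI simp: mcoeff_mmonom)
    finally show ?thesis .
  qed
  have "(\<Prod>v\<in>T. lform t T v - mmonom 1 {#v#}) = (\<Prod>v\<in>T. \<phi> {k\<in>T. v \<le> k})"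
    by (intro prod.cong refl, subst *, assumption, unfold \<phi>_def, intro sum.cong) auto
  moreover have "(\<Prod>v\<in>T. lform t T v - mmonom t {#v#}) = (\<Prod>v\<in>T. \<phi> {k\<in>T. v < k})"
    by (intro prod.cong refl, subst *, assumption, unfold \<phi>_def, intro sum.cong) auto
  moreover have "\<phi> T = mmonom t {#} * \<phi> {}"
    by (simp add: \<phi>_def sum_distrib_left mmonom_mult)
  ultimately show ?thesis
    using prod_upper_sets_telescope[OF assms, of \<phi>] by (auto simp: mult.assoc)
qed

lemma master_ser_inverse:
  "master_ser t * (eser 1 - mmonom t {#} * eser t) = mmonom (1 - t) {#}"
proof (rule mvps_eqI)
  fix m :: "'a multiset"
  have "mcoeff (master_ser t * (eser 1 - mmonom t {#} * eser t)) m =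
     mcoeff (master_ser t * eser 1) m - t * mcoeff (master_ser t * eser t) m"
    by (simp add: algebra_simps flip: mcoeff_mmonom_mult[of t "{#}", simplified])
  also have "\<dots> = mcoeff (mmonom (1 - t) {#}) m"
  proof (cases "m = {#}")
    case True
    thus ?thesis by (simp add: mcoeff_master_ser_mult_eser mcoeff_mmonom mcoeff_one)
  next
    case False
    let ?T = "set_mset m"
    let ?R = "\<Prod>v\<in>?T. lform t ?T v ^ (count m v - 1)"
    have "mcoeff (master_ser t * eser 1) m = mcoeff (mmonom t {#} *
        ((\<Prod>v\<in>?T. lform t ?T v - mmonom t {#v#}) * ?R)) m"
      using False
      by (simp add: mcoeff_master_ser_mult_eser prod.distrib prod_lform_diff mult.assoc)
    also have "\<dots> = t * mcoeff (master_ser t * eser t) m"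
      by (simp add: mcoeff_mmonom_mult mcoeff_master_ser_mult_eser prod.distrib)
    finally show ?thesis using False by (simp add: mcoeff_mmonom)
  qed
  finally show "mcoeff (master_ser t * (eser 1 - mmonom t {#} * eser t)) m =
    mcoeff (mmonom (1 - t) {#}) m" .
qed

lemma master_ser_hser:
  "master_ser t * eser t * (hser t - mmonom t {#} * hser 1) = mmonom (1 - t) {#} * hser 1"
proof -
  let ?X = "mmonom t {#} * master_ser t * eser t * hser 1"
  have "master_ser t * eser t * (hser t - mmonom t {#} * hser 1) =
      master_ser t * (hser t * eser t) - ?X"
    by (simp add: algebra_simps)
  \<comment> \<open>Both products equal 1; exchanging them makes \<open>hser 1\<close> a common
    factor.\<close>
  also have "\<dots> = master_ser t * (hser 1 * eser 1) - ?X"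
    by (simp add: hser_mult_eser)
  also have "\<dots> = master_ser t * (eser 1 - mmonom t {#} * eser t) * hser 1"
    by (simp add: algebra_simps)
  finally show ?thesis by (simp add: master_ser_inverse)
qed

section \<open>Permutations with prescribed excedance-descent set\<close>

text \<open>For weakly decreasing \<open>w\<close>: the barred word has no descent inside a block of
  equal letters.\<close>

definition exd_compatible :: "nat list \<Rightarrow> (nat \<Rightarrow> nat) \<Rightarrow> bool" where
  "exd_compatible w \<sigma> \<longleftrightarrow> (\<forall>j\<in>EXD (length w) \<sigma>. w ! j < w ! (j - 1))"

text \<open>Indexing by values rather than positions makes the admissible entries independent of
  each other. The flag marks barred values.\<close>

definition value_code :: "nat list \<Rightarrow> (nat \<Rightarrow> nat) \<Rightarrow> nat \<Rightarrow> nat \<times> bool" where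
  "value_code w \<sigma> = (\<lambda>v\<in>{1..length w}. (w ! (inv \<sigma> v - 1), inv \<sigma> v < v))"

text \<open>
  A barred value \<open>p\<close> may be put into the block of \<open>k\<close> iff that block has a position before \<open>p\<close>, a
  plain one iff it has a position at or after \<open>p\<close>; since barred letters come first and each kind
  increases along a block, this already forces every barred letter to be an excedance and every
  plain one not to be.
\<close>

definition choices :: "nat list \<Rightarrow> nat \<Rightarrow> (nat \<times> bool) set" where
  "choices w p = (\<lambda>i. (w ! (i - 1), i < p)) ` {1..length w}"

text \<open>Sorting the values by this key recovers the permutation from its code.\<close>

definition code_key :: "(nat \<Rightarrow> nat \<times> bool) \<Rightarrow> nat \<Rightarrow> int \<times> bool \<times> nat" where
  "code_key g v = (- int (fst (g v)), \<not> snd (g v), v)"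

section \<open>Injectivity of the value code\<close>

lemma sorted_rev_nth_le:
  "sorted (rev w) \<Longrightarrow> i \<le> j \<Longrightarrow> j < length w \<Longrightarrow> w ! j \<le> w ! i"
  by (simp add: sorted_rev_iff_nth_mono)

lemma value_code_apply:
  assumes "\<sigma> permutes {1..length w}" "i \<in> {1..length w}"
  shows "value_code w \<sigma> (\<sigma> i) = (w ! (i - 1), i < \<sigma> i)"
  using assms permutes_in_image[OF assms(1), of i]
  by (simp add: value_code_def permutes_inverses)

text \<open>The letter order is lexicographic on pairs, since \<open>False < True\<close> puts
  barred letters first.\<close>

lemma bar_word_not_less_iff:
  "\<not> letter_less (bar_word \<sigma> j) (bar_word \<sigma> i) \<longleftrightarrow>
     (\<not> i < \<sigma> i, \<sigma> i) \<le> (\<not> j < \<sigma> j, \<sigma> j)"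
  by (auto simp: bar_word_def)

text \<open>From left to right the blocks carry decreasing letters, hence the negation in
  \<open>code_key\<close>; inside a block, compatibility orders the letters of the barred
  word.\<close>

lemma map_code_key_eq_sort:
  assumes "\<sigma> permutes {1..length w}" "sorted (rev w)" "exd_compatible w \<sigma>"
  defines "g \<equiv> value_code w \<sigma>"
  shows "map (code_key g \<circ> \<sigma>) [1..<Suc (length w)] = sort (map (code_key g) [1..<Suc (length w)])"
proof (rule properties_for_sort[symmetric])
  have "image_mset \<sigma> (mset_set {1..length w}) = mset_set {1..length w}"
    using assms(1) by (simp add: image_mset_mset_set permutes_inj_on permutes_image)
  hence "image_mset (code_key g) (image_mset \<sigma> (mset_set {1..length w})) =
      image_mset (code_key g) (mset_set {1..length w})" by simp
  thus "mset (map (code_key g \<circ> \<sigma>) [1..<Suc (length w)]) =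
      mset (map (code_key g) [1..<Suc (length w)])"
    by (simp add: atLeastLessThanSuc_atLeastAtMost multiset.map_comp del: upt_Suc)
  show "sorted (map (code_key g \<circ> \<sigma>) [1..<Suc (length w)])"
    unfolding sorted_iff_nth_Suc
  proof (intro allI impI)
    fix i assume "Suc i < length (map (code_key g \<circ> \<sigma>) [1..<Suc (length w)])"
    hence i: "Suc i < length w" by (simp del: upt_Suc)
    have "Suc i \<notin> EXD (length w) \<sigma>" if "w ! i = w ! Suc i"
      using assms(3) that unfolding exd_compatible_def by force
    hence "\<not> letter_less (bar_word \<sigma> (Suc (Suc i))) (bar_word \<sigma> (Suc i))" if "w ! i = w ! Suc i"
      using i that by (simp add: EXD_def)
    moreover have "w ! Suc i \<le> w ! i" using assms(2) i by (simp add: sorted_rev_nth_le)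
    ultimately have "(- int (w ! i), \<not> Suc i < \<sigma> (Suc i), \<sigma> (Suc i)) \<le>
        (- int (w ! Suc i), \<not> Suc (Suc i) < \<sigma> (Suc (Suc i)), \<sigma> (Suc (Suc i)))"
      unfolding bar_word_not_less_iff by fastforce
    thus "map (code_key g \<circ> \<sigma>) [1..<Suc (length w)] ! i \<le>
       map (code_key g \<circ> \<sigma>) [1..<Suc (length w)] ! Suc i"
      using i assms(1) by (simp add: g_def code_key_def value_code_apply nth_append del: upt_Suc)
  qed
qed

text \<open>The sorted list of keys depends on the code alone, and the last components of the keys
  spell out the permutation.\<close>

lemma inj_on_value_code:
  assumes "sorted (rev w)"
  shows "inj_on (value_code w) {\<sigma>. \<sigma> permutes {1..length w} \<and> exd_compatible w \<sigma>}"
proof (rule inj_onI)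
  fix \<sigma> \<tau>
  assume *: "\<sigma> \<in> {\<sigma>. \<sigma> permutes {1..length w} \<and> exd_compatible w \<sigma>}"
    "\<tau> \<in> {\<sigma>. \<sigma> permutes {1..length w} \<and> exd_compatible w \<sigma>}"
    and eq: "value_code w \<sigma> = value_code w \<tau>"
  define g where "g = value_code w \<sigma>"
  have "map (code_key g \<circ> \<sigma>) [1..<Suc (length w)] = map (code_key g \<circ> \<tau>) [1..<Suc (length w)]"
    using map_code_key_eq_sort[of \<sigma> w] map_code_key_eq_sort[of \<tau> w] * assms eq
    by (simp add: g_def)
  hence "\<sigma> i = \<tau> i" if "i \<in> {1..length w}" for i
    using that by (auto simp: code_key_def simp del: upt_Suc)
  moreover have "\<sigma> i = \<tau> i" if "i \<notin> {1..length w}" for i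
    using that * by (auto simp: permutes_def)
  ultimately show "\<sigma> = \<tau>" by blast
qed

lemma value_code_in_choices:
  assumes "\<sigma> permutes {1..length w}"
  shows "value_code w \<sigma> \<in> PiE {1..length w} (choices w)"
    and "image_mset (fst \<circ> value_code w \<sigma>) (mset_set {1..length w}) = mset w"
proof -
  have inv: "inv \<sigma> permutes {1..length w}" using assms by (rule permutes_inv)
  show "value_code w \<sigma> \<in> PiE {1..length w} (choices w)"
    unfolding value_code_def choices_def
    using permutes_in_image[OF inv] by (auto intro!: imageI)
  have "image_mset (fst \<circ> value_code w \<sigma>) (mset_set {1..length w}) =
      image_mset (\<lambda>i. w ! (i - 1)) (image_mset (inv \<sigma>) (mset_set {1..length w}))"
    by (auto simp: multiset.map_comp value_code_def intro!: image_mset_cong)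
  also have "image_mset (inv \<sigma>) (mset_set {1..length w}) = mset_set {1..length w}"
    using inv by (simp add: image_mset_mset_set permutes_inj_on permutes_image)
  also have "image_mset (\<lambda>i. w ! (i - 1)) (mset_set {1..length w}) =
      image_mset (\<lambda>i. w ! (i - 1)) (image_mset Suc (mset_set {0..<length w}))"
    by (simp add: image_mset_mset_set atLeastLessThanSuc_atLeastAtMost)
  also have "\<dots> = mset (map ((!) w) [0..<length w])"
    by (simp add: multiset.map_comp comp_def)
  finally show "image_mset (fst \<circ> value_code w \<sigma>) (mset_set {1..length w}) = mset w"
    by (simp add: map_nth comp_def)
qed

text \<open>Sorting the values by key defines \<sigma>. The crux is that the flags in
  \<open>g\<close> are then its actual excedance flags.\<close>

lemma value_code_surj:
  assumes w: "sorted (rev w)"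
    and g: "g \<in> PiE {1..length w} (choices w)"
    and m: "image_mset (fst \<circ> g) (mset_set {1..length w}) = mset w"
  shows "\<exists>\<sigma>. \<sigma> permutes {1..length w} \<and> exd_compatible w \<sigma> \<and> value_code w \<sigma> = g"
proof -
  define n where "n = length w"
  define ks where "ks = sort (map (code_key g) [1..<Suc n])"
  define xs where "xs = map (snd \<circ> snd) ks"
  define \<sigma> where "\<sigma> i = (if i \<in> {1..n} then xs ! (i - 1) else i)" for i
  have mset_xs: "mset xs = mset_set {1..n}"
    by (simp add: xs_def ks_def multiset.map_comp comp_def code_key_def
        atLeastLessThanSuc_atLeastAtMost del: upt_Suc)
  have set_xs: "set xs = {1..n}" using arg_cong[OF mset_xs, of set_mset] by simp
  have len: "length xs = n" "length ks = n" by (simp_all add: xs_def ks_def)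
  have dist: "distinct xs"
    by (rule card_distinct) (simp add: set_xs len)
  have ks: "ks ! i = code_key g (xs ! i)" if "i < n" for i
  proof -
    have "ks ! i \<in> set ks" using that len by simp
    thus ?thesis using that len by (auto simp: ks_def xs_def code_key_def)
  qed
  have "sorted ks" by (simp add: ks_def)
  hence step: "code_key g (xs ! i) \<le> code_key g (xs ! Suc i)" if "Suc i < n" for i
    using that by (auto simp: sorted_iff_nth_Suc len ks simp flip: ks)
  have w_eq: "w = map (fst \<circ> g) xs"
  proof -
    have "mset (rev (map (fst \<circ> g) xs)) = mset (rev w)" using m mset_xs by (simp add: n_def)
    moreover have "sorted (rev (map (fst \<circ> g) xs))"
      unfolding sorted_rev_iff_nth_Suc using step by (force simp: len code_key_def)
    ultimately have "rev (map (fst \<circ> g) xs) = rev w"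
      using w by (metis properties_for_sort)
    thus ?thesis by simp
  qed
  have fst_g: "fst (g (xs ! i)) = w ! i" if "i < n" for i
    using that len by (simp add: w_eq)
  \<comment> \<open>List indices start at 0, hence \<open>Suc i'\<close>. This is some position in
    the block of \<open>i\<close>, not necessarily that of \<open>i\<close> itself.\<close>
  have choice: "\<exists>i'<n. w ! i' = w ! i \<and> (snd (g (xs ! i)) \<longleftrightarrow> Suc i' < xs ! i)" if "i < n" for i
  proof -
    have "xs ! i \<in> {1..n}" using that set_xs len nth_mem by blast
    hence "g (xs ! i) \<in> choices w (xs ! i)" using g by (auto simp: n_def)
    then obtain i' where "i' \<in> {1..n}" "g (xs ! i) = (w ! (i' - 1), i' < xs ! i)"
      by (auto simp: choices_def n_def)
    thus ?thesis using fst_g[OF that] by (intro exI[of _ "i' - 1"]) auto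
  qed
  have same_block: "(\<not> snd (g (xs ! i)), xs ! i) < (\<not> snd (g (xs ! Suc i)), xs ! Suc i)"
    if "Suc i < n" "w ! i = w ! Suc i" for i
  proof -
    have "xs ! i \<noteq> xs ! Suc i" using that dist len by (simp add: nth_eq_iff_index_eq)
    thus ?thesis using step[OF that(1)] that fst_g[of i] fst_g[of "Suc i"]
      by (auto simp: code_key_def)
  qed
  \<comment> \<open>Within a block a barred letter is preceded by smaller barred ones, so the bound
    propagates to the right. At the start of a block \<open>i'\<close> cannot lie further left, so
    its bound suffices.\<close>
  have barred: "Suc i < xs ! i" if "i < n" "snd (g (xs ! i))" for i
    using that
  proof (induction i)
    case 0
    thus ?case using choice[of 0] by auto
  next
    case (Suc i)
    show ?case
    proof (cases "w ! i = w ! Suc i")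
      case True
      thus ?thesis using same_block[of i] Suc by auto
    next
      case False
      obtain i' where i': "i' < n" "w ! i' = w ! Suc i" "Suc i' < xs ! Suc i"
        using choice[of "Suc i"] Suc.prems by blast
      have "\<not> i' \<le> i"
        using False i' Suc.prems sorted_rev_nth_le[OF w, of i' i] sorted_rev_nth_le[OF w, of i "Suc i"]
        by (auto simp: n_def)
      thus ?thesis using i' by simp
    qed
  qed
  \<comment> \<open>The mirror argument: start at the end of a block, where \<open>i'\<close> cannot
    lie further right, and propagate to the left.\<close>
  have plain: "xs ! i \<le> Suc i" if "i < n" "\<not> snd (g (xs ! i))" for i
    using that
  proof (induction "n - i" arbitrary: i rule: less_induct)
    case less
    obtain i' where i': "i' < n" "w ! i' = w ! i" "xs ! i \<le> Suc i'"
      using choice[of i] less.prems by (meson not_less)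
    show ?case
    proof (cases "Suc i < n \<and> w ! i = w ! Suc i")
      case True
      hence "xs ! i < xs ! Suc i" "\<not> snd (g (xs ! Suc i))"
        using same_block[of i] less.prems by auto
      thus ?thesis using less.hyps[of "Suc i"] True diff_less_mono2[of i "Suc i" n] by simp
    next
      case False
      have "\<not> Suc i \<le> i'"
        using False i' sorted_rev_nth_le[OF w, of "Suc i" i'] sorted_rev_nth_le[OF w, of i "Suc i"]
        by (auto simp: n_def)
      thus ?thesis using i' by simp
    qed
  qed
  have bar: "snd (g (xs ! i)) \<longleftrightarrow> Suc i < xs ! i" if "i < n" for i
    using barred[OF that] plain[OF that] by linarith
  have \<sigma>_Suc: "\<sigma> (Suc i) = xs ! i" if "i < n" for i using that by (simp add: \<sigma>_def)
  have perm: "\<sigma> permutes {1..n}"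
  proof (rule bij_imp_permutes)
    have "inj_on \<sigma> {1..n}"
      using dist len by (auto simp: \<sigma>_def inj_on_def nth_eq_iff_index_eq)
    moreover have "\<sigma> ` {1..n} \<subseteq> {1..n}"
    proof
      fix x assume "x \<in> \<sigma> ` {1..n}"
      then obtain i where "i \<in> {1..n}" "x = xs ! (i - 1)" by (auto simp: \<sigma>_def)
      moreover from this have "x \<in> set xs" using len by (auto intro: nth_mem)
      ultimately show "x \<in> {1..n}" using set_xs by simp
    qed
    ultimately show "bij_betw \<sigma> {1..n} {1..n}"
      by (simp add: bij_betw_def endo_inj_surj)
  qed (auto simp: \<sigma>_def)
  have compat: "exd_compatible w \<sigma>"
    unfolding exd_compatible_def
  proof
    fix j assume j: "j \<in> EXD (length w) \<sigma>"
    then obtain i where i: "j = Suc i" "Suc i < n"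
      by (cases j) (auto simp: EXD_def n_def)
    have "w ! i \<noteq> w ! Suc i"
    proof
      assume "w ! i = w ! Suc i"
      from same_block[OF i(2) this] have "(\<not> Suc i < \<sigma> (Suc i), \<sigma> (Suc i)) \<le>
          (\<not> Suc (Suc i) < \<sigma> (Suc (Suc i)), \<sigma> (Suc (Suc i)))"
        using i bar[of i] bar[of "Suc i"] by (auto simp: \<sigma>_Suc)
      thus False using j i unfolding bar_word_not_less_iff[symmetric] by (simp add: EXD_def)
    qed
    thus "w ! j < w ! (j - 1)"
      using sorted_rev_nth_le[OF w, of i "Suc i"] i by (simp add: n_def)
  qed
  have "value_code w \<sigma> v = g v" for v
  proof (cases "v \<in> {1..n}")
    case True
    then obtain i where i: "i < n" "v = xs ! i" using set_xs len by (metis in_set_conv_nth)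
    have "value_code w \<sigma> (\<sigma> (Suc i)) = (w ! i, Suc i < \<sigma> (Suc i))"
      using value_code_apply[of \<sigma> w "Suc i"] perm i by (simp add: n_def)
    thus ?thesis using i fst_g[of i] bar[of i] by (simp add: \<sigma>_Suc prod_eq_iff)
  next
    case False
    thus ?thesis using g by (auto simp: value_code_def n_def PiE_def extensional_def)
  qed
  thus ?thesis using perm compat by (auto simp: n_def)
qed

lemma bij_betw_value_code:
  assumes "sorted (rev w)"
  shows "bij_betw (value_code w) {\<sigma>. \<sigma> permutes {1..length w} \<and> exd_compatible w \<sigma>}
    {g \<in> PiE {1..length w} (choices w). image_mset (fst \<circ> g) (mset_set {1..length w}) = mset w}"
  unfolding bij_betw_def
  using inj_on_value_code[OF assms] value_code_in_choices value_code_surj[OF assms]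
  by (auto simp del: One_nat_def o_apply) (metis (mono_tags, lifting) image_eqI mem_Collect_eq)

section \<open>Weighted count of compatible permutations\<close>

lemma card_value_code_barred:
  assumes "\<sigma> permutes {1..length w}"
  shows "card {v \<in> {1..length w}. snd (value_code w \<sigma> v)} = exc (length w) \<sigma>"
proof -
  have "{v \<in> {1..length w}. snd (value_code w \<sigma> v)} = \<sigma> ` {i \<in> {1..<length w}. i < \<sigma> i}"
  proof (intro equalityI subsetI)
    fix v assume v: "v \<in> {v \<in> {1..length w}. snd (value_code w \<sigma> v)}"
    define i where "i = inv \<sigma> v"
    have "v = \<sigma> i" using assms by (simp add: i_def permutes_inverses)
    moreover have "i \<in> {1..length w}" "i < v"
      using v assms permutes_in_image[OF permutes_inv[OF assms], of v]
      by (auto simp: value_code_def i_def)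
    \<comment> \<open>Since \<open>i < v \<le> length w\<close>, the position lies in the half-open
      range of \<open>exc\<close>.\<close>
    ultimately show "v \<in> \<sigma> ` {i \<in> {1..<length w}. i < \<sigma> i}" using v by auto
  next
    fix v assume "v \<in> \<sigma> ` {i \<in> {1..<length w}. i < \<sigma> i}"
    then obtain i where i: "i \<in> {1..<length w}" "i < \<sigma> i" "v = \<sigma> i" by auto
    hence "\<sigma> i \<in> {1..length w}" using permutes_in_image[OF assms, of i] by auto
    thus "v \<in> {v \<in> {1..length w}. snd (value_code w \<sigma> v)}"
      using value_code_apply[OF assms, of i] i by simp
  qed
  thus ?thesis
    using assms by (simp add: exc_def card_image permutes_inj_on)
qed

text \<open>Distributing the product gives one term per \<open>g\<close>; the coefficient of
  \<open>mset w\<close> keeps exactly the codes of compatible permutations.\<close>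

lemma sum_exd_compatible:
  fixes t :: "'a::comm_ring_1"
  assumes "sorted (rev w)"
  shows "(\<Sum>\<sigma> | \<sigma> permutes {1..length w} \<and> exd_compatible w \<sigma>. t ^ exc (length w) \<sigma>) =
    mcoeff (\<Prod>p\<in>{1..length w}. \<Sum>c\<in>choices w p. mmonom (if snd c then t else 1) {#fst c#}) (mset w)"
proof -
  let ?I = "{1..length w}"
  have "(\<Prod>p\<in>?I. \<Sum>c\<in>choices w p. mmonom (if snd c then t else 1) {#fst c#}) =
      (\<Sum>g\<in>PiE ?I (choices w). mmonom (t ^ card {v \<in> ?I. snd (g v)})
          (image_mset (fst \<circ> g) (mset_set ?I)))"
  proof (subst prod_sum_PiE)
    show "(\<Sum>g\<in>PiE ?I (choices w). \<Prod>p\<in>?I. mmonom (if snd (g p) then t else 1) {#fst (g p)#}) =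
      (\<Sum>g\<in>PiE ?I (choices w). mmonom (t ^ card {v \<in> ?I. snd (g v)})
          (image_mset (fst \<circ> g) (mset_set ?I)))"
    proof (rule sum.cong[OF refl])
      fix g
      have "(\<Prod>p\<in>?I. if snd (g p) then t else 1) = t ^ card {v \<in> ?I. snd (g v)}"
        by (subst prod.inter_filter[symmetric]) auto
      moreover have "(\<Sum>p\<in>A. {#fst (g p)#}) = image_mset (fst \<circ> g) (mset_set A)" if "finite A" for A
        using that by (induction A) auto
      ultimately show "(\<Prod>p\<in>?I. mmonom (if snd (g p) then t else 1) {#fst (g p)#}) =
          mmonom (t ^ card {v \<in> ?I. snd (g v)}) (image_mset (fst \<circ> g) (mset_set ?I))"
        by (simp add: prod_mmonom)
    qed
  qed (auto simp: choices_def)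
  hence "mcoeff (\<Prod>p\<in>?I. \<Sum>c\<in>choices w p. mmonom (if snd c then t else 1) {#fst c#}) (mset w) =
      (\<Sum>g\<in>PiE ?I (choices w). if image_mset (fst \<circ> g) (mset_set ?I) = mset w
         then t ^ card {v \<in> ?I. snd (g v)} else 0)"
    by (simp only: mcoeff_sum mcoeff_mmonom eq_commute[of "mset w"])
  also have "\<dots> = (\<Sum>g\<in>{g \<in> PiE ?I (choices w). image_mset (fst \<circ> g) (mset_set ?I) = mset w}.
      t ^ card {v \<in> ?I. snd (g v)})"
    by (rule sum.inter_filter[symmetric]) (intro finite_PiE, auto simp: choices_def)
  also have "\<dots> = (\<Sum>\<sigma> | \<sigma> permutes ?I \<and> exd_compatible w \<sigma>.
      t ^ card {v \<in> ?I. snd (value_code w \<sigma> v)})"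
    by (rule sum.reindex_bij_betw[OF bij_betw_value_code[OF assms], symmetric])
  also have "\<dots> = (\<Sum>\<sigma> | \<sigma> permutes ?I \<and> exd_compatible w \<sigma>. t ^ exc (length w) \<sigma>)"
    by (rule sum.cong[OF refl], subst card_value_code_barred) auto
  finally show ?thesis by simp
qed

text \<open>Blocks of larger letters lie entirely before position \<open>p\<close>, those of smaller
  letters entirely after it. The block of \<open>v\<close> contains \<open>p\<close>, so it admits a
  plain value; it admits a barred one only if it starts before \<open>p\<close>, otherwise
  \<open>t y\<^sub>v\<close> is lost.\<close>

lemma sum_choices_eq_lform:
  fixes t :: "'a::comm_ring_1"
  assumes w: "sorted (rev w)" and p: "p \<in> {1..length w}"
  defines "v \<equiv> w ! (p - 1)"
  shows "(\<Sum>c\<in>choices w p. mmonom (if snd c then t else 1) {#fst c#}) =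
    lform t (set w) v - (if \<forall>i\<in>{1..<p}. w ! (i - 1) \<noteq> v then mmonom t {#v#} else 0)"
proof -
  let ?first = "\<forall>i\<in>{1..<p}. w ! (i - 1) \<noteq> v"
  define A where "A = {k \<in> set w. v < k \<or> k = v \<and> \<not> ?first}"
  define B where "B = {k \<in> set w. k \<le> v}"
  have vw: "v \<in> set w" using p by (auto simp: v_def)
  have mono: "w ! (j - 1) \<le> w ! (i - 1)" if "i \<le> j" "j \<in> {1..length w}" for i j
    using that by (intro sorted_rev_nth_le[OF w]) auto
  have ch: "(k, b) \<in> choices w p \<longleftrightarrow> (\<exists>i\<in>{1..length w}. w ! (i - 1) = k \<and> (b \<longleftrightarrow> i < p))" for k b
    by (auto simp: choices_def)
  have ex: "\<exists>i\<in>{1..length w}. w ! (i - 1) = k" if "k \<in> set w" for k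
  proof -
    from that obtain i where "i < length w" "w ! i = k" by (auto simp: in_set_conv_nth)
    thus ?thesis by (intro bexI[of _ "Suc i"]) auto
  qed
  have T: "(k, True) \<in> choices w p \<longleftrightarrow> k \<in> A" for k
  proof
    assume "(k, True) \<in> choices w p"
    then obtain i where "i \<in> {1..length w}" "w ! (i - 1) = k" "i < p" by (auto simp: ch)
    thus "k \<in> A" using mono[of i p] p by (auto simp: A_def v_def)
  next
    assume k: "k \<in> A"
    show "(k, True) \<in> choices w p"
    proof (cases "k = v")
      case True
      thus ?thesis using k p by (auto simp: A_def ch)
    next
      case False
      hence vk: "v < k" using k by (auto simp: A_def)
      obtain i where i: "i \<in> {1..length w}" "w ! (i - 1) = k" using ex[of k] k unfolding A_def by blast
      hence "i < p" using mono[of p i] vk by (auto simp: v_def not_less[symmetric])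
      thus ?thesis using i by (auto simp: ch)
    qed
  qed
  have F: "(k, False) \<in> choices w p \<longleftrightarrow> k \<in> B" for k
  proof
    assume "(k, False) \<in> choices w p"
    then obtain i where "i \<in> {1..length w}" "w ! (i - 1) = k" "p \<le> i" by (auto simp: ch)
    thus "k \<in> B" using mono[of p i] by (auto simp: B_def v_def)
  next
    assume k: "k \<in> B"
    show "(k, False) \<in> choices w p"
    proof (cases "k = v")
      case True
      thus ?thesis using p by (auto simp: ch v_def)
    next
      case False
      hence vk: "k < v" using k by (auto simp: B_def)
      obtain i where i: "i \<in> {1..length w}" "w ! (i - 1) = k" using ex[of k] k unfolding B_def by blast
      hence "\<not> i < p" using mono[of i p] p vk by (auto simp: v_def)
      thus ?thesis using i by (auto simp: ch)
    qed
  qed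
  have "choices w p = A \<times> {True} \<union> B \<times> {False}"
    using T F by (auto simp: set_eq_iff) (metis (full_types))+
  hence "(\<Sum>c\<in>choices w p. mmonom (if snd c then t else 1) {#fst c#}) =
      (\<Sum>c\<in>A \<times> {True}. mmonom (if snd c then t else 1) {#fst c#}) +
      (\<Sum>c\<in>B \<times> {False}. mmonom (if snd c then t else 1) {#fst c#})"
    by (simp, intro sum.union_disjoint) (auto simp: A_def B_def)
  also have "\<dots> = (\<Sum>k\<in>A. mmonom t {#k#}) + (\<Sum>k\<in>B. mmonom 1 {#k#})"
    by (simp add: sum.cartesian_product' )
  also have "\<dots> = (\<Sum>k\<in>set w. if v < k \<or> k = v \<and> \<not> ?first then mmonom t {#k#} else 0) +
      (\<Sum>k\<in>set w. if k \<le> v then mmonom 1 {#k#} else 0)"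
    unfolding A_def B_def by (simp only: sum.inter_filter List.finite_set)
  also have "\<dots> = (\<Sum>k\<in>set w. mmonom (if v < k then t else if k = v then 1 + t else 1) {#k#} -
      (if k = v then if ?first then mmonom t {#v#} else 0 else 0))"
    unfolding sum.distrib[symmetric]
    by (rule sum.cong) (auto intro!: mvps_eqI simp: mcoeff_mmonom)
  also have "\<dots> = lform t (set w) v - (if ?first then mmonom t {#v#} else 0)"
    using vw by (simp add: sum_subtractf lform_def)
  finally show ?thesis .
qed

text \<open>Group the factors by the block containing \<open>p\<close>, read as a position. In each
  block only the least position gives the diminished form.\<close>

lemma sum_exd_compatible_eq_mcoeff:
  fixes t :: "'a::comm_ring_1"
  assumes w: "sorted (rev w)"
  shows "(\<Sum>\<sigma> | \<sigma> permutes {1..length w} \<and> exd_compatible w \<sigma>. t ^ exc (length w) \<sigma>) =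
    mcoeff (master_ser t * eser t) (mset w)"
proof -
  let ?I = "{1..length w}" and ?T = "set w"
  let ?X = "\<lambda>p. \<Sum>c\<in>choices w p. mmonom (if snd c then t else 1) {#fst c#}"
  have "(\<Prod>p\<in>?I. ?X p) = (\<Prod>v\<in>?T. \<Prod>p\<in>{p\<in>?I. w ! (p - 1) = v}. ?X p)"
    by (rule prod.group[symmetric]) auto
  also have "\<dots> = (\<Prod>v\<in>?T. (lform t ?T v - mmonom t {#v#}) * lform t ?T v ^ (count (mset w) v - 1))"
  proof (rule prod.cong[OF refl])
    fix v assume "v \<in> ?T"
    define P where "P = {p\<in>?I. w ! (p - 1) = v}"
    obtain i where "i < length w" "w ! i = v" using \<open>v \<in> ?T\<close> by (auto simp: in_set_conv_nth)
    hence ne: "Suc i \<in> P" by (simp add: P_def)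
    have fin: "finite P" by (simp add: P_def)
    have "P = Suc ` {i. i < length w \<and> w ! i = v}"
    proof (intro equalityI subsetI)
      fix p assume "p \<in> P" thus "p \<in> Suc ` {i. i < length w \<and> w ! i = v}"
        by (intro image_eqI[of _ _ "p - 1"]) (auto simp: P_def)
    qed (auto simp: P_def)
    hence card: "card P = count (mset w) v"
      by (simp add: card_image count_mset count_list_eq_length_filter length_filter_conv_card eq_commute[of v])
    have P_iff: "p \<in> P \<longleftrightarrow> p \<in> ?I \<and> w ! (p - 1) = v" for p by (simp add: P_def)
    have f: "Min P \<in> P" using fin ne by (intro Min_in) auto
    have first: "?X (Min P) = lform t ?T v - mmonom t {#v#}"
    proof -
      have "w ! (i - 1) \<noteq> v" if "i \<in> {1..<Min P}" for i
        using that f Min_le[OF fin, of i] by (auto simp: P_iff[of i] P_iff[of "Min P"])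
      thus ?thesis using f by (subst sum_choices_eq_lform[OF w]) (auto simp: P_iff)
    qed
    have other: "?X p = lform t ?T v" if "p \<in> P - {Min P}" for p
    proof -
      have "Min P < p" using that fin by (metis DiffE Min_le le_neq_implies_less singletonI)
      hence "\<exists>i\<in>{1..<p}. w ! (i - 1) = v" using f by (intro bexI[of _ "Min P"]) (auto simp: P_iff)
      thus ?thesis using that by (subst sum_choices_eq_lform[OF w]) (auto simp: P_iff)
    qed
    have "(\<Prod>p\<in>P. ?X p) = ?X (Min P) * (\<Prod>p\<in>P - {Min P}. ?X p)"
      using fin f by (rule prod.remove)
    also have "(\<Prod>p\<in>P - {Min P}. ?X p) = (\<Prod>p\<in>P - {Min P}. lform t ?T v)"
      by (rule prod.cong[OF refl other])
    also have "\<dots> = lform t ?T v ^ (count (mset w) v - 1)"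
      using fin f card by simp
    finally show "(\<Prod>p\<in>{p\<in>?I. w ! (p - 1) = v}. ?X p) =
        (lform t ?T v - mmonom t {#v#}) * lform t ?T v ^ (count (mset w) v - 1)"
      unfolding first unfolding P_def .
  qed
  finally show ?thesis
    unfolding sum_exd_compatible[OF w] mcoeff_master_ser_mult_eser by simp
qed

section \<open>Transfer to series in t and z\<close>

text \<open>Substitutes \<open>z x\<^sub>v\<close> for \<open>x\<^sub>v\<close> and 0 for the
  indeterminate with index 0, and moves \<open>t\<close> outside. It is multiplicative, so
  identities without \<open>z\<close> carry over.\<close>

definition graded_ser :: "(nat, int fps) mvps \<Rightarrow> xps fps fps" where
  "graded_ser f = Abs_fps (\<lambda>n. Abs_fps (\<lambda>j. Abs_mvps (\<lambda>m.
     if size m = n \<and> 0 \<notin># m then fps_nth (mcoeff f m) j else 0)))"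

lemma mcoeff_graded_ser:
  "mcoeff (fps_nth (fps_nth (graded_ser f) n) j) m =
     (if size m = n \<and> 0 \<notin># m then fps_nth (mcoeff f m) j else 0)"
  by (simp add: graded_ser_def)

lemma gen_eqI:
  assumes "\<And>n j m. mcoeff (fps_nth (fps_nth f n) j) m = mcoeff (fps_nth (fps_nth g n) j) m"
  shows "f = (g :: ('v, 'a::comm_ring_1) mvps fps fps)"
  by (intro fps_ext mvps_eqI assms)

lemma graded_ser_diff: "graded_ser (f - g) = graded_ser f - graded_ser g"
  by (rule gen_eqI) (simp add: mcoeff_graded_ser)

lemma graded_ser_one: "graded_ser 1 = 1"
  by (rule gen_eqI) (auto simp: mcoeff_graded_ser mcoeff_one)

lemma graded_ser_mult: "graded_ser (f * g) = graded_ser f * graded_ser g"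
proof (rule gen_eqI)
  fix n j m
  let ?c = "\<lambda>k i p. (if size (fst p) = k \<and> 0 \<notin># fst p then fps_nth (mcoeff f (fst p)) i else 0) *
    (if size (snd p) = n - k \<and> 0 \<notin># snd p then fps_nth (mcoeff g (snd p)) (j - i) else 0)"
  have inner: "(\<Sum>k=0..n. ?c k i p) = (if size m = n \<and> 0 \<notin># m
      then fps_nth (mcoeff f (fst p)) i * fps_nth (mcoeff g (snd p)) (j - i) else 0)"
    if "p \<in> msplits m" for i p
  proof -
    have m: "m = fst p + snd p" using that by (auto simp: msplits_def)
    \<comment> \<open>Degrees add up, so only \<open>k = size (fst p)\<close> contributes.\<close>
    have "(\<Sum>k=0..n. ?c k i p) = (\<Sum>k=0..n. if k = size (fst p) then ?c (size (fst p)) i p else 0)"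
      by (rule sum.cong) auto
    also have "\<dots> = (if size (fst p) \<le> n then ?c (size (fst p)) i p else 0)"
      by (subst sum.delta) auto
    finally show ?thesis by (auto simp: m)
  qed
  have "mcoeff (fps_nth (fps_nth (graded_ser f * graded_ser g) n) j) m =
      (\<Sum>k=0..n. \<Sum>i=0..j. \<Sum>p\<in>msplits m. ?c k i p)"
    by (simp add: fps_mult_nth fps_sum_nth mcoeff_mult mcoeff_graded_ser case_prod_unfold)
  also have "\<dots> = (\<Sum>k=0..n. \<Sum>p\<in>msplits m. \<Sum>i=0..j. ?c k i p)"
    by (rule sum.cong[OF refl sum.swap])
  also have "\<dots> = (\<Sum>p\<in>msplits m. \<Sum>k=0..n. \<Sum>i=0..j. ?c k i p)"
    by (rule sum.swap)
  also have "\<dots> = (\<Sum>p\<in>msplits m. \<Sum>i=0..j. \<Sum>k=0..n. ?c k i p)"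
    by (rule sum.cong[OF refl sum.swap])
  also have "\<dots> = (\<Sum>p\<in>msplits m. \<Sum>i=0..j. if size m = n \<and> 0 \<notin># m
      then fps_nth (mcoeff f (fst p)) i * fps_nth (mcoeff g (snd p)) (j - i) else 0)"
    by (intro sum.cong refl inner)
  also have "\<dots> = mcoeff (fps_nth (fps_nth (graded_ser (f * g)) n) j) m"
    by (cases "size m = n \<and> 0 \<notin># m")
      (auto simp: mcoeff_graded_ser mcoeff_mult case_prod_unfold fps_sum_nth fps_mult_nth)
  finally show "mcoeff (fps_nth (fps_nth (graded_ser (f * g)) n) j) m =
    mcoeff (fps_nth (fps_nth (graded_ser f * graded_ser g) n) j) m" ..
qed

section \<open>The series of the identity as images under \<open>graded_ser\<close>\<close>

lemma tvar_eq: "tvar = graded_ser (mmonom fps_X {#})"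
  by (rule gen_eqI) (auto simp: tvar_def mcoeff_graded_ser mcoeff_mmonom mcoeff_one fps_X_def)

lemma mcoeff_hsym: "mcoeff (hsym n) m = (if size m = n \<and> 0 \<notin># m then 1 else 0)"
proof -
  have "{w \<in> {w. length w = n \<and> (\<forall>i\<in>set w. 1 \<le> i) \<and> sorted w}. mset w = m} =
      (if size m = n \<and> 0 \<notin># m then {sorted_list_of_multiset m} else {})"
  proof -
    have "w = sorted_list_of_multiset m" if "sorted w" "mset w = m" for w
      using that by (metis sorted_list_of_multiset_mset sorted_sort_id)
    moreover have "(\<forall>i\<in>set w. 1 \<le> i) \<longleftrightarrow> 0 \<notin> set w" for w :: "nat list"
      by (metis less_one linorder_not_less)
    ultimately show ?thesis by (auto simp flip: size_mset)
  qed
  thus ?thesis by (simp add: hsym_def word_series_def)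
qed

lemma Hgen_eq: "Hgen = graded_ser (hser 1)"
  by (rule gen_eqI) (simp add: Hgen_def mcoeff_graded_ser mcoeff_hsym hser_def)

lemma Hgen_compose_eq: "fps_compose Hgen (zvar * tvar) = graded_ser (hser fps_X)"
proof -
  \<comment> \<open>Substituting \<open>c z\<close> for \<open>z\<close> multiplies the
    \<open>n\<close>th coefficient by \<open>c ^ n\<close>.\<close>
  have "fps_compose Hgen (zvar * tvar) = Abs_fps (\<lambda>n. fps_X ^ n * fps_nth Hgen n)"
    unfolding zvar_def tvar_def mult.commute[of fps_X] by (rule fps_compose_linear)
  thus ?thesis
    by (intro gen_eqI) (simp add: Hgen_def mcoeff_graded_ser mcoeff_hsym hser_def fps_X_power_mult_nth
        fps_X_power_nth)
qed

text \<open>A monomial has only one weakly decreasing word, so its coefficient is 0 or 1.\<close>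

lemma mcoeff_Fquasi:
  "mcoeff (Fquasi (EXD n \<sigma>) n) m =
    (if size m = n \<and> 0 \<notin># m \<and> exd_compatible (rev (sorted_list_of_multiset m)) \<sigma> then 1 else 0)"
proof -
  let ?w = "rev (sorted_list_of_multiset m)"
  have desc: "(\<forall>j\<in>{1..<length w}. w ! j \<le> w ! (j - 1)) \<longleftrightarrow> sorted (rev w)" for w :: "nat list"
    unfolding sorted_rev_iff_nth_Suc
  proof (intro iffI allI impI ballI)
    fix i assume *: "\<forall>j\<in>{1..<length w}. w ! j \<le> w ! (j - 1)" "Suc i < length w"
    show "w ! Suc i \<le> w ! i" using bspec[OF *(1), of "Suc i"] *(2) by simp
  next
    fix j assume "\<forall>i. Suc i < length w \<longrightarrow> w ! Suc i \<le> w ! i" "j \<in> {1..<length w}"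
    thus "w ! j \<le> w ! (j - 1)" by (cases j) auto
  qed
  have pos: "(\<forall>i\<in>set w. 1 \<le> i) \<longleftrightarrow> 0 \<notin> set w" for w :: "nat list"
    by (metis less_one linorder_not_less)
  have uniq: "w = ?w" if "sorted (rev w)" "mset w = m" for w
    using that by (metis mset_rev rev_rev_ident sorted_list_of_multiset_mset sorted_sort_id)
  have "{w \<in> {w. length w = n \<and> (\<forall>i\<in>set w. 1 \<le> i) \<and> (\<forall>j\<in>{1..<n}. w ! j \<le> w ! (j - 1)) \<and>
       (\<forall>j\<in>EXD n \<sigma>. w ! j < w ! (j - 1))}. mset w = m} =
     {w. sorted (rev w) \<and> mset w = m \<and> length w = n \<and> 0 \<notin> set w \<and> exd_compatible w \<sigma>}"
    unfolding exd_compatible_def pos desc[symmetric] by auto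
  also have "\<dots> = (if size m = n \<and> 0 \<notin># m \<and> exd_compatible ?w \<sigma> then {?w} else {})"
    using uniq by (auto simp flip: size_mset)
  finally show ?thesis by (simp add: Fquasi_def word_series_def)
qed

lemma Qgen_eq: "Qgen = graded_ser (master_ser fps_X * eser fps_X)"
proof (rule gen_eqI)
  fix n j :: nat and m :: "nat multiset"
  let ?w = "rev (sorted_list_of_multiset m)"
  have fin: "finite {\<sigma>. \<sigma> permutes {1..n} \<and> P \<sigma>}" for P
    by (rule finite_subset[of _ "{\<sigma>. \<sigma> permutes {1..n}}"]) (auto simp: finite_permutations)
  have "mcoeff (Qeuler n j) m = fps_nth (mcoeff (master_ser fps_X * eser fps_X) m) j"
    if m: "size m = n" "0 \<notin># m"
  proof -
    have len: "length ?w = n" and ms: "mset ?w = m" using m by (simp_all flip: size_mset)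
    have "mcoeff (Qeuler n j) m = (\<Sum>\<sigma> | \<sigma> permutes {1..n} \<and> exc n \<sigma> = j.
        if exd_compatible ?w \<sigma> then 1 else 0)"
      using m by (simp add: Qeuler_def mcoeff_Fquasi)
    \<comment> \<open>Moving the excedance condition into the summand lets it be read as a
      coefficient of \<open>t ^ j\<close>.\<close>
    also have "\<dots> = (\<Sum>\<sigma> | \<sigma> permutes {1..n} \<and> exd_compatible ?w \<sigma>. if exc n \<sigma> = j then 1 else 0)"
      using fin by (simp add: sum.If_cases Int_def conj_ac)
    also have "\<dots> = fps_nth (\<Sum>\<sigma> | \<sigma> permutes {1..n} \<and> exd_compatible ?w \<sigma>. fps_X ^ exc n \<sigma>) j"
      by (simp add: fps_sum_nth fps_X_power_nth eq_commute[of j])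
    also have "\<dots> = fps_nth (mcoeff (master_ser fps_X * eser fps_X) m) j"
      using sum_exd_compatible_eq_mcoeff[of ?w "fps_X :: int fps"] len ms by simp
    finally show ?thesis .
  qed
  moreover have "mcoeff (Qeuler n j) m = 0" if "\<not> (size m = n \<and> 0 \<notin># m)"
    unfolding Qeuler_def using that by (auto simp: mcoeff_Fquasi)
  ultimately show "mcoeff (fps_nth (fps_nth Qgen n) j) m =
      mcoeff (fps_nth (fps_nth (graded_ser (master_ser fps_X * eser fps_X)) n) j) m"
    by (simp add: Qgen_def mcoeff_graded_ser)
qed

lemma one_minus_fps_X_unit: "(1 - fps_X :: 'a::comm_ring_1 fps) * Abs_fps (\<lambda>_. 1) = 1"
  by (rule fps_ext) (simp add: algebra_simps)

theorem theorem2p1: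
  shows "(fps_compose Hgen (zvar * tvar) - tvar * Hgen) dvd 1
    \<and> Qgen = unit_quot ((1 - tvar) * Hgen) (fps_compose Hgen (zvar * tvar) - tvar * Hgen)"
proof
  let ?t = "fps_X :: int fps"
  let ?q = "master_ser ?t * eser ?t :: (nat, int fps) mvps"
  let ?d = "hser ?t - mmonom ?t {#} * hser 1 :: (nat, int fps) mvps"
  have one: "1 - mmonom ?t {#} = (mmonom (1 - ?t) {#} :: (nat, int fps) mvps)"
    by (rule mvps_eqI) (simp add: mcoeff_one mcoeff_mmonom)
  have d: "fps_compose Hgen (zvar * tvar) - tvar * Hgen = graded_ser ?d"
    unfolding Hgen_compose_eq by (simp add: Hgen_eq tvar_eq graded_ser_diff graded_ser_mult)
  have a: "(1 - tvar) * Hgen = graded_ser (mmonom (1 - ?t) {#} * hser 1)"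
    by (simp add: Hgen_eq tvar_eq graded_ser_diff graded_ser_mult graded_ser_one flip: one)
  \<comment> \<open>By \<open>master_ser_hser\<close>, \<open>?q * ?d\<close> is
    \<open>(1 - t) H(1)\<close>; the geometric series inverts \<open>1 - t\<close> and
    \<open>eser 1\<close> inverts \<open>H(1)\<close>.\<close>
  have "?d * (?q * eser 1 * mmonom (Abs_fps (\<lambda>_. 1)) {#}) =
      (?q * ?d) * eser 1 * mmonom (Abs_fps (\<lambda>_. 1)) {#}"
    by (simp only: ac_simps)
  also have "\<dots> = mmonom (1 - ?t) {#} * hser 1 * eser 1 * mmonom (Abs_fps (\<lambda>_. 1)) {#}"
    by (simp only: master_ser_hser)
  also have "\<dots> = (mmonom (1 - ?t) {#} * mmonom (Abs_fps (\<lambda>_. 1)) {#}) * (hser 1 * eser 1)"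
    by (simp only: ac_simps)
  also have "\<dots> = 1"
    by (simp add: mmonom_mult one_minus_fps_X_unit hser_mult_eser one_eq_mmonom)
  finally have "graded_ser ?d * graded_ser (?q * eser 1 * mmonom (Abs_fps (\<lambda>_. 1)) {#}) = 1"
    by (simp only: graded_ser_one flip: graded_ser_mult)
  thus unit: "(fps_compose Hgen (zvar * tvar) - tvar * Hgen) dvd 1"
    unfolding d by (metis dvdI)
  show "Qgen = unit_quot ((1 - tvar) * Hgen) (fps_compose Hgen (zvar * tvar) - tvar * Hgen)"
    unfolding unit_quot_eq_iff[OF unit] unfolding d a Qgen_eq
    by (simp only: master_ser_hser flip: graded_ser_mult)
qed

end
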